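(* Let $(M^n,g)$ be an $n$-dimensional Riemannian manifold, let $f>0$ be a smooth function on $M$, and let $\tilde M = M\times_f \mathbb{R}$ be the static spacetime with metric $\tilde g = g - f^2dt^2$. Suppose $(\tilde g,\tilde\lambda,\tilde\phi)$ is an almost gradient Ricci soliton on $\tilde M$ and that the Hessian of $f$ on $(M,g)$ vanishes, $H^f=0$. Then $(g,\lambda,\phi)$, where $\phi=\tilde\phi|_M$ and $\lambda=\tilde\lambda|_M$, is an almost gradient Ricci soliton on $M$.
   Context: An almost gradient Ricci soliton $(g,\lambda,\phi)$ on a semi-Riemannian manifold $(N,g)$ consists of smooth functions $\phi$ (potential function) and $\lambda$ (soliton function, called "soliton constant") on $N$ with $H^{\phi}+S+\lambda g=0$, where $H^\phi$ is the Hessian of $\phi$ and $S$ is the Ricci tensor of $g$. The static spacetime $M\times_f\mathbb{R}$ is the product manifold $M\times\mathbb{R}$ with the Lorentzian metric $\tilde g=g-f^2dt^2$, $t$ being the coordinate on $\mathbb{R}$. $M$ is identified with a slice $M\times\{t_0\}$ of $\tilde M$, and restriction to $M$ means restriction to this slice. *)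

theory Defs
  imports "HOL-Analysis.Analysis"
begin

section \<open>Smooth maps between Euclidean spaces\<close>

text \<open>Only used on open sets \<open>S\<close>: all iterated directional derivatives exist and are continuous.\<close>

primrec k_smooth_on ::
  "nat \<Rightarrow> 'a::euclidean_space set \<Rightarrow> ('a \<Rightarrow> 'b::real_normed_vector) \<Rightarrow> bool" where
  "k_smooth_on 0 S F \<longleftrightarrow> continuous_on S F"
| "k_smooth_on (Suc k) S F \<longleftrightarrow>
     (\<forall>z\<in>S. F differentiable (at z)) \<and>
     (\<forall>v. k_smooth_on k S (\<lambda>z. frechet_derivative F (at z) v))"

definition smooth_on :: "'a::euclidean_space set \<Rightarrow> ('a \<Rightarrow> 'b::real_normed_vector) \<Rightarrow> bool" where
  "smooth_on S F \<longleftrightarrow> (\<forall>k. k_smooth_on k S F)"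


section \<open>Smooth manifolds\<close>

text \<open>A chart is a pair of its domain and its coordinate map. The points of a manifold form a whole
  type \<open>'m\<close>; its dimension is \<open>DIM('e)\<close>. The atlas need not be maximal.\<close>

type_synonym ('m, 'e) chart = "'m set \<times> ('m \<Rightarrow> 'e)"

definition smooth_atlas ::
  "('m::{t2_space,second_countable_topology}, 'e::euclidean_space) chart set \<Rightarrow> bool" where
  "smooth_atlas A \<longleftrightarrow>
     (\<Union>(U, x)\<in>A. U) = UNIV \<and>
     (\<forall>(U, x)\<in>A. open U \<and> open (x ` U) \<and> homeomorphism U (x ` U) x (inv_into U x)) \<and>
     (\<forall>(U, x)\<in>A. \<forall>(V, y)\<in>A. smooth_on (x ` (U \<inter> V)) (y \<circ> inv_into U x))"

definition smooth_fun_on ::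
  "('m::topological_space, 'e::euclidean_space) chart set \<Rightarrow> 'm set \<Rightarrow> ('m \<Rightarrow> real) \<Rightarrow> bool" where
  "smooth_fun_on A W h \<longleftrightarrow> (\<forall>(U, x)\<in>A. smooth_on (x ` (U \<inter> W)) (h \<circ> inv_into U x))"

definition smooth_near ::
  "('m::topological_space, 'e::euclidean_space) chart set \<Rightarrow> 'm \<Rightarrow> ('m \<Rightarrow> real) set" where
  "smooth_near A p = {h. \<exists>W. open W \<and> p \<in> W \<and> smooth_fun_on A W h}"

text \<open>Tangent vectors at \<open>p\<close> are derivations on the functions that are smooth near \<open>p\<close>. The Leibniz
  rule makes them depend on the germ only; the last conjunct makes them extensional.\<close>

type_synonym 'm tangent = "('m \<Rightarrow> real) \<Rightarrow> real"

definition tangent_space ::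
  "('m::topological_space, 'e::euclidean_space) chart set \<Rightarrow> 'm \<Rightarrow> 'm tangent set" where
  "tangent_space A p = {X.
     (\<forall>h\<in>smooth_near A p. \<forall>k\<in>smooth_near A p. X (\<lambda>q. h q + k q) = X h + X k) \<and>
     (\<forall>a. \<forall>h\<in>smooth_near A p. X (\<lambda>q. a * h q) = a * X h) \<and>
     (\<forall>h\<in>smooth_near A p. \<forall>k\<in>smooth_near A p. X (\<lambda>q. h q * k q) = X h * k p + h p * X k) \<and>
     (\<forall>h. h \<notin> smooth_near A p \<longrightarrow> X h = 0)}"

text \<open>The tangent vector at \<open>p\<close> whose coordinate vector in the chart \<open>c\<close> is \<open>v\<close>; for a basis vector
  \<open>v\<close> it is the corresponding coordinate field.\<close>

definition coord_vector ::
  "('m::topological_space, 'e::euclidean_space) chart set \<Rightarrow> ('m, 'e) chart \<Rightarrow> 'm \<Rightarrow> 'e \<Rightarrow> 'm tangent"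
  where
  "coord_vector A c p v = (\<lambda>h. if h \<in> smooth_near A p
     then frechet_derivative (h \<circ> inv_into (fst c) (snd c)) (at (snd c p)) v else 0)"


section \<open>Metrics\<close>

text \<open>For a metric \<open>g\<close>, \<open>g p X Y\<close> is relevant only for \<open>X\<close>, \<open>Y\<close> in the tangent space at \<open>p\<close>.\<close>

type_synonym 'm metric = "'m \<Rightarrow> 'm tangent \<Rightarrow> 'm tangent \<Rightarrow> real"

text \<open>The matrix of \<open>g\<close> in a chart, as a function on the chart's range.\<close>

definition chart_metric ::
  "('m::topological_space, 'e::euclidean_space) chart set \<Rightarrow> 'm metric \<Rightarrow> ('m, 'e) chart
    \<Rightarrow> 'e \<Rightarrow> 'e \<Rightarrow> 'e \<Rightarrow> real" where
  "chart_metric A g c z u v =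
     (let p = inv_into (fst c) (snd c) z in g p (coord_vector A c p u) (coord_vector A c p v))"

definition smooth_sym_tensor ::
  "('m::topological_space, 'e::euclidean_space) chart set \<Rightarrow> 'm metric \<Rightarrow> bool" where
  "smooth_sym_tensor A g \<longleftrightarrow>
     (\<forall>p. \<forall>X\<in>tangent_space A p. \<forall>Y\<in>tangent_space A p.
        g p X Y = g p Y X \<and>
        (\<forall>a. g p (\<lambda>h. a * X h) Y = a * g p X Y) \<and>
        (\<forall>Z\<in>tangent_space A p. g p (\<lambda>h. X h + Z h) Y = g p X Y + g p Z Y)) \<and>
     (\<forall>(U, x)\<in>A. \<forall>u v. smooth_on (x ` U) (\<lambda>z. chart_metric A g (U, x) z u v))"

definition riemannian_manifold ::
  "('m::{t2_space,second_countable_topology}, 'e::euclidean_space) chart set \<Rightarrow> 'm metric \<Rightarrow> bool"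
  where
  "riemannian_manifold A g \<longleftrightarrow> smooth_atlas A \<and> smooth_sym_tensor A g \<and>
     (\<forall>p. \<forall>X\<in>tangent_space A p. X \<noteq> (\<lambda>_. 0) \<longrightarrow> g p X X > 0)"

definition index_of :: "('e::euclidean_space \<Rightarrow> 'e \<Rightarrow> real) \<Rightarrow> nat" where
  "index_of B = Max {dim S |S. subspace S \<and> (\<forall>v\<in>S. v \<noteq> 0 \<longrightarrow> B v v < 0)}"

definition semi_riemannian_manifold ::
  "('m::{t2_space,second_countable_topology}, 'e::euclidean_space) chart set \<Rightarrow> 'm metric \<Rightarrow> bool"
  where
  "semi_riemannian_manifold A g \<longleftrightarrow> smooth_atlas A \<and> smooth_sym_tensor A g \<and>
     (\<forall>p. \<forall>X\<in>tangent_space A p. (\<forall>Y\<in>tangent_space A p. g p X Y = 0) \<longrightarrow> X = (\<lambda>_. 0)) \<and>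
     (\<exists>\<nu>. \<forall>(U, x)\<in>A. \<forall>p\<in>U. index_of (chart_metric A g (U, x) (x p)) = \<nu>)"


section \<open>Levi-Civita connection, curvature and Hessian in a chart\<close>

text \<open>\<open>G\<close> is a metric on an open subset of \<open>'e\<close> and vector fields are functions \<open>'e \<Rightarrow> 'e\<close>.
  \<open>christoffel G z u v\<close> is the covariant derivative at \<open>z\<close> of the constant (coordinate) field \<open>v\<close>
  along \<open>u\<close>, given by the Koszul formula.\<close>

definition christoffel :: "('e::euclidean_space \<Rightarrow> 'e \<Rightarrow> 'e \<Rightarrow> real) \<Rightarrow> 'e \<Rightarrow> 'e \<Rightarrow> 'e \<Rightarrow> 'e" where
  "christoffel G z u v = (THE w. \<forall>y. 2 * G z w y =
       frechet_derivative (\<lambda>q. G q v y) (at z) u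
     + frechet_derivative (\<lambda>q. G q u y) (at z) v
     - frechet_derivative (\<lambda>q. G q u v) (at z) y)"

definition cov_deriv ::
  "('e::euclidean_space \<Rightarrow> 'e \<Rightarrow> 'e \<Rightarrow> real) \<Rightarrow> ('e \<Rightarrow> 'e) \<Rightarrow> ('e \<Rightarrow> 'e) \<Rightarrow> 'e \<Rightarrow> 'e" where
  "cov_deriv G X Y z = frechet_derivative Y (at z) (X z) + christoffel G z (X z) (Y z)"

definition lie_bracket :: "('e::euclidean_space \<Rightarrow> 'e) \<Rightarrow> ('e \<Rightarrow> 'e) \<Rightarrow> 'e \<Rightarrow> 'e" where
  "lie_bracket X Y z = frechet_derivative Y (at z) (X z) - frechet_derivative X (at z) (Y z)"

definition curvature ::
  "('e::euclidean_space \<Rightarrow> 'e \<Rightarrow> 'e \<Rightarrow> real) \<Rightarrow> ('e \<Rightarrow> 'e) \<Rightarrow> ('e \<Rightarrow> 'e) \<Rightarrow> ('e \<Rightarrow> 'e) \<Rightarrow> 'e \<Rightarrow> 'e" where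
  "curvature G X Y Z z = cov_deriv G X (cov_deriv G Y Z) z - cov_deriv G Y (cov_deriv G X Z) z
     - cov_deriv G (lie_bracket X Y) Z z"

text \<open>\<open>Ric(u,v)\<close> is the trace of \<open>w \<mapsto> R(w,u)v\<close>; with these signs it is positive on round spheres.
  Ricci tensor and Hessian are evaluated on constant (coordinate) fields.\<close>

definition chart_ricci ::
  "('e::euclidean_space \<Rightarrow> 'e \<Rightarrow> 'e \<Rightarrow> real) \<Rightarrow> 'e \<Rightarrow> 'e \<Rightarrow> 'e \<Rightarrow> real" where
  "chart_ricci G z u v = (\<Sum>b\<in>Basis. curvature G (\<lambda>_. b) (\<lambda>_. u) (\<lambda>_. v) z \<bullet> b)"

definition chart_hessian ::
  "('e::euclidean_space \<Rightarrow> 'e \<Rightarrow> 'e \<Rightarrow> real) \<Rightarrow> ('e \<Rightarrow> real) \<Rightarrow> 'e \<Rightarrow> 'e \<Rightarrow> 'e \<Rightarrow> real" where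
  "chart_hessian G F z u v =
     frechet_derivative (\<lambda>q. frechet_derivative F (at q) v) (at z) u
     - frechet_derivative F (at z) (cov_deriv G (\<lambda>_. u) (\<lambda>_. v) z)"

text \<open>Hessian and Ricci tensor of a manifold at \<open>p\<close>, evaluated on the tangent vectors with coordinate
  vectors \<open>u\<close>, \<open>v\<close> in the chart \<open>c\<close>. Since both are tensor fields, an identity between them is
  an identity of these components in all charts of the atlas.\<close>

definition hessian ::
  "('m::topological_space, 'e::euclidean_space) chart set \<Rightarrow> 'm metric \<Rightarrow> ('m \<Rightarrow> real)
    \<Rightarrow> ('m, 'e) chart \<Rightarrow> 'm \<Rightarrow> 'e \<Rightarrow> 'e \<Rightarrow> real" where
  "hessian A g h c p u v =
     chart_hessian (chart_metric A g c) (h \<circ> inv_into (fst c) (snd c)) (snd c p) u v"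

definition ricci ::
  "('m::topological_space, 'e::euclidean_space) chart set \<Rightarrow> 'm metric
    \<Rightarrow> ('m, 'e) chart \<Rightarrow> 'm \<Rightarrow> 'e \<Rightarrow> 'e \<Rightarrow> real" where
  "ricci A g c p u v = chart_ricci (chart_metric A g c) (snd c p) u v"


section \<open>Solitons and static spacetimes\<close>

definition almost_gradient_ricci_soliton ::
  "('m::{t2_space,second_countable_topology}, 'e::euclidean_space) chart set \<Rightarrow> 'm metric
    \<Rightarrow> ('m \<Rightarrow> real) \<Rightarrow> ('m \<Rightarrow> real) \<Rightarrow> bool" where
  "almost_gradient_ricci_soliton A g l \<phi> \<longleftrightarrow>
     semi_riemannian_manifold A g \<and> smooth_fun_on A UNIV l \<and> smooth_fun_on A UNIV \<phi> \<and>
     (\<forall>c\<in>A. \<forall>p\<in>fst c. \<forall>u v. hessian A g \<phi> c p u v + ricci A g c p u v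
        + l p * g p (coord_vector A c p u) (coord_vector A c p v) = 0)"

text \<open>The product atlas on \<open>M \<times> \<real>\<close>, the line carrying its standard chart.\<close>

definition static_atlas :: "('m, 'e) chart set \<Rightarrow> ('m \<times> real, 'e \<times> real) chart set" where
  "static_atlas A = (\<lambda>(U, x). (U \<times> UNIV, \<lambda>(p, t). (x p, t))) ` A"

text \<open>Differential at a point of the projection onto \<open>M\<close>. As \<open>snd\<close> is the coordinate \<open>t\<close>, the value
  of \<open>dt\<close> on a tangent vector \<open>X\<close> of \<open>M \<times> \<real>\<close> is \<open>X snd\<close>.\<close>

definition proj_tangent ::
  "('m::topological_space, 'e::euclidean_space) chart set \<Rightarrow> 'm \<Rightarrow> ('m \<times> real) tangent \<Rightarrow> 'm tangent"
  where
  "proj_tangent A p X = (\<lambda>h. if h \<in> smooth_near A p then X (h \<circ> fst) else 0)"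

definition static_metric ::
  "('m::topological_space, 'e::euclidean_space) chart set \<Rightarrow> 'm metric \<Rightarrow> ('m \<Rightarrow> real)
    \<Rightarrow> ('m \<times> real) metric" where
  "static_metric A g f = (\<lambda>(p, t) X Y.
     g p (proj_tangent A p X) (proj_tangent A p Y) - (f p)\<^sup>2 * (X snd * Y snd))"

end

theory Submission
  imports Defs
begin

text \<open>
  On horizontal vectors, the Ricci tensor of the static metric \<open>g - f\<^sup>2 dt\<^sup>2\<close> is \<open>S - H\<^sup>f / f\<close>, where \<open>S\<close>
  is the Ricci tensor of \<open>g\<close>. The slices are totally geodesic, so the Hessian of a function on the
  spacetime restricts to the Hessian of the restricted function, and the metric restricts to \<open>g\<close>. If
  \<open>H\<^sup>f = 0\<close>, the soliton equation of the spacetime on horizontal vectors at points of a slice is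
  therefore the soliton equation of \<open>g\<close>.

  The two computations are done in charts, in the locale \<open>static_chart\<close>. The Koszul formula determines
  the Christoffel symbols of the static metric (\<open>christoffel_H\<close>); with them one finds the Ricci tensor
  (\<open>chart_ricci_H\<close>) and the Hessian (\<open>chart_hessian_H\<close>). The curvature involves derivatives of
  Christoffel symbols, and these are given by a definite description. Their differentiability is the
  one analytic point: they solve a linear system with smooth nondegenerate coefficients, and the
  inverse function theorem applies (\<open>nondegenerate_solution_differentiable\<close>).

  To transfer this to manifolds, coordinate vectors are shown to be tangent vectors that depend
  linearly and injectively on their components. Hence a Riemannian metric has a positive definite
  matrix in each chart, which provides the nondegeneracy above and the index \<open>0\<close>, and the static
  metric has the expected block matrix in a product chart (\<open>static_chart_metric\<close>).
\<close>

section \<open>Calculus of smooth maps\<close>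

lemma frechet_derivative_cong_open:
  assumes "open S" "z \<in> S" "\<And>q. q \<in> S \<Longrightarrow> F q = G q"
  shows "frechet_derivative F (at z) = frechet_derivative G (at z)"
proof -
  have "(F has_derivative D) (at z) \<longleftrightarrow> (G has_derivative D) (at z)" for D
    using assms by (intro iffI; elim has_derivative_transform_within_open) auto
  then show ?thesis
    by (simp add: frechet_derivative_def)
qed

lemma differentiable_cong_open:
  assumes "F differentiable at z" "open S" "z \<in> S" "\<And>q. q \<in> S \<Longrightarrow> F q = G q"
  shows "G differentiable at z"
proof -
  obtain D where "(F has_derivative D) (at z)" using assms(1) by (auto simp: differentiable_def)
  then have "(G has_derivative D) (at z)"
    by (rule has_derivative_transform_within_open) (use assms in auto)
  then show ?thesis by (rule differentiableI)
qed

lemma differentiable_imp_has_frechet: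
  "F differentiable at z \<Longrightarrow> (F has_derivative frechet_derivative F (at z)) (at z)"
  by (simp add: frechet_derivative_works)

lemma k_smooth_on_cong:
  assumes "k_smooth_on k S F" "open S" "\<And>z. z \<in> S \<Longrightarrow> F z = G z"
  shows "k_smooth_on k S G"
  using assms(1,3)
proof (induction k arbitrary: F G)
  case 0
  have "continuous_on S F \<longleftrightarrow> continuous_on S G"
    by (rule continuous_on_cong[OF refl 0(2)])
  with 0(1) show ?case by simp
next
  case (Suc k)
  have F: "F differentiable at z" if "z \<in> S" for z
    using Suc.prems(1) that by simp
  have eq: "frechet_derivative F (at z) = frechet_derivative G (at z)" if "z \<in> S" for z
    by (rule frechet_derivative_cong_open[OF assms(2) that Suc.prems(2)])
  have "k_smooth_on k S (\<lambda>z. frechet_derivative F (at z) v)" for v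
    using Suc.prems(1) by simp
  then have "k_smooth_on k S (\<lambda>z. frechet_derivative G (at z) v)" for v
    by (rule Suc.IH) (simp only: eq)
  moreover have "G differentiable at z" if "z \<in> S" for z
    by (rule differentiable_cong_open[OF F[OF that] assms(2) that Suc.prems(2)])
  ultimately show ?case by simp
qed

lemma k_smooth_on_subset:
  assumes "k_smooth_on k S F" "T \<subseteq> S"
  shows "k_smooth_on k T F"
  using assms(1)
proof (induction k arbitrary: F)
  case 0
  then show ?case using continuous_on_subset[OF _ assms(2)] by simp
next
  case (Suc k)
  then show ?case using assms(2) by (simp add: subset_iff)
qed

lemma k_smooth_on_SucD:
  assumes "k_smooth_on (Suc k) S F"
  shows "k_smooth_on k S F"
  using assms
proof (induction k arbitrary: F)
  case 0
  then have "\<forall>z\<in>S. isCont F z" by (simp add: differentiable_imp_continuous_within)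
  then show ?case by (simp add: continuous_at_imp_continuous_on)
next
  case (Suc k)
  show ?case unfolding k_smooth_on.simps(2)[of k]
  proof (intro conjI allI)
    show "\<forall>z\<in>S. F differentiable at z" using Suc.prems by simp
    show "k_smooth_on k S (\<lambda>z. frechet_derivative F (at z) v)" for v
      by (rule Suc.IH) (rule conjunct2[OF Suc.prems[unfolded k_smooth_on.simps(2)[of "Suc k"]], rule_format])
  qed
qed

lemma k_smooth_on_const: "k_smooth_on k S (\<lambda>_. c)"
  by (induction k arbitrary: c) auto

text \<open>The closure properties are proved by induction on the order: each directional derivative of the
  new function is built, by the same or earlier operations, from functions of one order less. As
  \<open>frechet_derivative\<close> is known by a formula only on the open domain, \<open>k_smooth_on_cong\<close> is needed to
  replace it by that formula.\<close>

lemma k_smooth_on_linear_compose: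
  assumes "bounded_linear L" "k_smooth_on k S F" "open S"
  shows "k_smooth_on k S (\<lambda>z. L (F z))"
  using assms(2)
proof (induction k arbitrary: F)
  case 0
  then show ?case using bounded_linear.continuous_on[OF assms(1)] by auto
next
  case (Suc k)
  have d: "((\<lambda>z. L (F z)) has_derivative (\<lambda>v. L (frechet_derivative F (at z) v))) (at z)"
    if "z \<in> S" for z
    using Suc.prems that
    by (intro bounded_linear.has_derivative[OF assms(1)] differentiable_imp_has_frechet) auto
  have "k_smooth_on k S (\<lambda>z. L (frechet_derivative F (at z) v))" for v
    using Suc by auto
  then have "k_smooth_on k S (\<lambda>z. frechet_derivative (\<lambda>z. L (F z)) (at z) v)" for v
    by (rule k_smooth_on_cong[OF _ assms(3)]) (simp add: frechet_derivative_at[OF d, symmetric])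
  then show ?case using differentiableI[OF d] by simp
qed

lemma k_smooth_on_add:
  assumes "k_smooth_on k S F" "k_smooth_on k S G" "open S"
  shows "k_smooth_on k S (\<lambda>z. F z + G z)"
  using assms(1,2)
proof (induction k arbitrary: F G)
  case 0
  then show ?case by (auto intro: continuous_on_add)
next
  case (Suc k)
  have d: "((\<lambda>z. F z + G z) has_derivative
      (\<lambda>v. frechet_derivative F (at z) v + frechet_derivative G (at z) v)) (at z)"
    if "z \<in> S" for z
    using Suc.prems that by (intro has_derivative_add differentiable_imp_has_frechet) auto
  have "k_smooth_on k S (\<lambda>z. frechet_derivative F (at z) v + frechet_derivative G (at z) v)" for v
    using Suc by auto
  then have "k_smooth_on k S (\<lambda>z. frechet_derivative (\<lambda>z. F z + G z) (at z) v)" for v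
    by (rule k_smooth_on_cong[OF _ assms(3)]) (simp add: frechet_derivative_at[OF d, symmetric])
  then show ?case using differentiableI[OF d] by simp
qed

lemma k_smooth_on_mult:
  fixes F G :: "'a::euclidean_space \<Rightarrow> real"
  assumes "k_smooth_on k S F" "k_smooth_on k S G" "open S"
  shows "k_smooth_on k S (\<lambda>z. F z * G z)"
  using assms(1,2)
proof (induction k arbitrary: F G)
  case 0
  then show ?case by (auto intro: continuous_on_mult)
next
  case (Suc k)
  have d: "((\<lambda>z. F z * G z) has_derivative
      (\<lambda>v. F z * frechet_derivative G (at z) v + frechet_derivative F (at z) v * G z)) (at z)"
    if "z \<in> S" for z
    using Suc.prems that by (intro has_derivative_mult differentiable_imp_has_frechet) auto
  have "k_smooth_on k S
      (\<lambda>z. F z * frechet_derivative G (at z) v + frechet_derivative F (at z) v * G z)" for v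
    using Suc.prems by (intro k_smooth_on_add Suc.IH assms(3)) (auto intro: k_smooth_on_SucD)
  then have "k_smooth_on k S (\<lambda>z. frechet_derivative (\<lambda>z. F z * G z) (at z) v)" for v
    by (rule k_smooth_on_cong[OF _ assms(3)]) (simp add: frechet_derivative_at[OF d, symmetric])
  then show ?case using differentiableI[OF d] by simp
qed

text \<open>Precomposition with an affine map. Its two uses are the projection of a product onto a factor
  and the inclusion of a slice.\<close>

lemma frechet_derivative_affine_compose:
  assumes "bounded_linear L" "F differentiable at (L z + c)"
  shows "((\<lambda>z. F (L z + c)) has_derivative (\<lambda>v. frechet_derivative F (at (L z + c)) (L v))) (at z)"
proof -
  have "((\<lambda>z. L z + c) has_derivative L) (at z)"
    using bounded_linear_imp_has_derivative[OF assms(1)] by (auto intro!: derivative_eq_intros)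
  from diff_chain_at[OF this differentiable_imp_has_frechet[OF assms(2)]]
  show ?thesis by (simp add: o_def)
qed

lemma has_derivative_fst_compose:
  assumes "(F has_derivative D) (at z)"
  shows "((\<lambda>p. F (fst p)) has_derivative (\<lambda>v. D (fst v))) (at (z, t))"
proof -
  have "(fst has_derivative fst) (at (z, t))"
    by (rule bounded_linear_imp_has_derivative[OF bounded_linear_fst])
  from diff_chain_at[OF this, of F D] assms show ?thesis by (simp add: o_def)
qed

lemma k_smooth_on_affine_compose:
  assumes "bounded_linear L" "k_smooth_on k S F" "open T" "\<And>z. z \<in> T \<Longrightarrow> L z + c \<in> S"
  shows "k_smooth_on k T (\<lambda>z. F (L z + c))"
  using assms(2)
proof (induction k arbitrary: F)
  case 0
  have "continuous_on T (\<lambda>z. L z + c)"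
    by (intro continuous_intros bounded_linear.continuous_on[OF assms(1)])
  with 0 show ?case using assms(4) by (auto intro: continuous_on_compose2)
next
  case (Suc k)
  have d: "((\<lambda>z. F (L z + c)) has_derivative (\<lambda>v. frechet_derivative F (at (L z + c)) (L v))) (at z)"
    if "z \<in> T" for z
    using Suc.prems that assms(4) by (intro frechet_derivative_affine_compose assms(1)) auto
  have "k_smooth_on k T (\<lambda>z. frechet_derivative F (at (L z + c)) (L v))" for v
    using Suc.prems by (intro Suc.IH[of "\<lambda>z. frechet_derivative F (at z) (L v)"]) auto
  then have "k_smooth_on k T (\<lambda>z. frechet_derivative (\<lambda>z. F (L z + c)) (at z) v)" for v
    by (rule k_smooth_on_cong[OF _ assms(3)]) (simp add: frechet_derivative_at[OF d, symmetric])
  then show ?case using differentiableI[OF d] by simp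
qed

lemma k_smooth_on_linear:
  assumes "bounded_linear L"
  shows "k_smooth_on k S L"
proof (cases k)
  case 0
  then show ?thesis using assms by (simp add: linear_continuous_on)
next
  case (Suc j)
  have d: "(L has_derivative L) (at z)" for z
    by (rule bounded_linear_imp_has_derivative[OF assms])
  then show ?thesis
    by (simp add: Suc differentiableI[OF d] frechet_derivative_at[OF d, symmetric] k_smooth_on_const)
qed

lemma smooth_on_cong:
  assumes "smooth_on S F" "open S" "\<And>z. z \<in> S \<Longrightarrow> F z = G z"
  shows "smooth_on S G"
  using assms k_smooth_on_cong unfolding smooth_on_def by blast

lemma smooth_on_subset: "smooth_on S F \<Longrightarrow> T \<subseteq> S \<Longrightarrow> smooth_on T F"
  using k_smooth_on_subset unfolding smooth_on_def by blast

lemma smooth_on_add: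
  assumes "smooth_on S F" "smooth_on S G" "open S"
  shows "smooth_on S (\<lambda>z. F z + G z)"
  using assms by (simp add: smooth_on_def k_smooth_on_add)

lemma smooth_on_mult:
  fixes F G :: "'a::euclidean_space \<Rightarrow> real"
  assumes "smooth_on S F" "smooth_on S G" "open S"
  shows "smooth_on S (\<lambda>z. F z * G z)"
  using assms by (simp add: smooth_on_def k_smooth_on_mult)

lemma smooth_on_const: "smooth_on S (\<lambda>_. c)"
  by (simp add: smooth_on_def k_smooth_on_const)

lemma smooth_on_linear: "bounded_linear L \<Longrightarrow> smooth_on S L"
  by (simp add: smooth_on_def k_smooth_on_linear)

lemma smooth_on_linear_compose:
  assumes "bounded_linear L" "smooth_on S F" "open S"
  shows "smooth_on S (\<lambda>z. L (F z))"
  using assms by (simp add: smooth_on_def k_smooth_on_linear_compose)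

lemma smooth_on_affine_compose:
  assumes "bounded_linear L" "smooth_on S F" "open T" "\<And>z. z \<in> T \<Longrightarrow> L z + c \<in> S"
  shows "smooth_on T (\<lambda>z. F (L z + c))"
  using assms k_smooth_on_affine_compose[of L _ S F T c] unfolding smooth_on_def by blast

lemma smooth_on_differentiable:
  assumes "smooth_on S F" "z \<in> S"
  shows "F differentiable at z"
  using assms(1)[unfolded smooth_on_def, rule_format, of "Suc 0"] assms(2) by simp

lemma smooth_on_frechet_derivative:
  assumes "smooth_on S F"
  shows "smooth_on S (\<lambda>z. frechet_derivative F (at z) v)"
  unfolding smooth_on_def
proof
  fix k
  have "k_smooth_on (Suc k) S F" using assms by (simp add: smooth_on_def)
  then show "k_smooth_on k S (\<lambda>z. frechet_derivative F (at z) v)" by simp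
qed


section \<open>Nondegenerate metrics in a chart\<close>

text \<open>The right-hand side of the Koszul formula for coordinate fields.\<close>

definition koszul :: "('e::euclidean_space \<Rightarrow> 'e \<Rightarrow> 'e \<Rightarrow> real) \<Rightarrow> 'e \<Rightarrow> 'e \<Rightarrow> 'e \<Rightarrow> 'e \<Rightarrow> real" where
  "koszul G z u v y =
       frechet_derivative (\<lambda>q. G q v y) (at z) u
     + frechet_derivative (\<lambda>q. G q u y) (at z) v
     - frechet_derivative (\<lambda>q. G q u v) (at z) y"

lemma christoffel_eqI:
  assumes "\<And>y. 2 * G z w y = koszul G z u v y"
    and "\<And>w'. (\<And>y. G z w' y = G z w y) \<Longrightarrow> w' = w"
  shows "christoffel G z u v = w"
  unfolding christoffel_def koszul_def[symmetric]
proof (rule the_equality)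
  show "\<forall>y. 2 * G z w y = koszul G z u v y" using assms(1) by simp
  show "w' = w" if "\<forall>y. 2 * G z w' y = koszul G z u v y" for w'
    using that assms(1) by (intro assms(2)) (metis mult_cancel_left zero_neq_numeral)
qed

lemma linear_expand:
  fixes r :: "'e::euclidean_space \<Rightarrow> real"
  assumes "linear r"
  shows "r y = (\<Sum>c\<in>Basis. (y \<bullet> c) * r c)"
proof -
  interpret linear r by fact
  have "r (\<Sum>c\<in>Basis. (y \<bullet> c) *\<^sub>R c) = (\<Sum>c\<in>Basis. (y \<bullet> c) * r c)"
    by (simp add: sum scale)
  then show ?thesis by (simp add: euclidean_representation)
qed

lemma bilinear_expand_left:
  fixes B :: "'e::euclidean_space \<Rightarrow> 'e \<Rightarrow> real"
  assumes "bilinear B"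
  shows "B w y = (\<Sum>c\<in>Basis. (w \<bullet> c) * B c y)"
  using assms by (intro linear_expand) (simp add: bilinear_def)

text \<open>The endomorphism that represents a bilinear form with respect to the Euclidean inner product.\<close>

definition form_map :: "('e::euclidean_space \<Rightarrow> 'e \<Rightarrow> real) \<Rightarrow> 'e \<Rightarrow> 'e" where
  "form_map B w = (\<Sum>b\<in>Basis. B w b *\<^sub>R b)"

lemma form_map_inner_Basis: "b \<in> Basis \<Longrightarrow> form_map B w \<bullet> b = B w b"
  unfolding form_map_def by simp

lemma form_map_inner:
  assumes "bilinear B"
  shows "form_map B w \<bullet> y = B w y"
proof -
  have "linear (B w)" using assms by (simp add: bilinear_def)
  from linear_expand[OF this, of y] show ?thesis
    by (simp add: form_map_def inner_sum_left) (simp add: inner_commute mult.commute)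
qed

lemma linear_form_map:
  assumes "bilinear B"
  shows "linear (form_map B)"
proof (rule linearI)
  show "form_map B (v + w) = form_map B v + form_map B w" for v w
    by (rule euclidean_eqI)
      (simp add: form_map_inner_Basis inner_left_distrib bilinear_ladd[OF assms])
  show "form_map B (a *\<^sub>R w) = a *\<^sub>R form_map B w" for a w
    by (rule euclidean_eqI) (simp add: form_map_inner_Basis bilinear_lmul[OF assms])
qed

lemma bij_form_map:
  fixes B :: "'e::euclidean_space \<Rightarrow> 'e \<Rightarrow> real"
  assumes "bilinear B" "\<And>w. (\<And>y. B w y = 0) \<Longrightarrow> w = 0"
  shows "bij (form_map B)"
proof -
  have "inj (form_map B)"
    unfolding linear_injective_0[OF linear_form_map[OF assms(1)]]
  proof (intro allI impI)
    fix w assume "form_map B w = 0"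
    then have "B w y = 0" for y using form_map_inner[OF assms(1), of w y] by simp
    then show "w = 0" by (rule assms(2))
  qed
  then show ?thesis
    using linear_injective_imp_surjective[OF linear_form_map[OF assms(1)]] by (simp add: bij_def)
qed

text \<open>The solution \<open>w q\<close> of the linear system \<open>G q w = r q\<close> is obtained by inverting the map
  \<open>(q, w) \<mapsto> (q, G q w)\<close>. Its derivative is block triangular with an invertible diagonal, so that the
  inverse function theorem gives differentiability of the solution.\<close>

lemma nondegenerate_solution_differentiable:
  fixes G :: "'e::euclidean_space \<Rightarrow> 'e \<Rightarrow> 'e \<Rightarrow> real"
  assumes S: "open S" "z \<in> S"
    and bil: "\<And>q. q \<in> S \<Longrightarrow> bilinear (G q)"
    and nondeg: "\<And>q w. q \<in> S \<Longrightarrow> (\<And>y. G q w y = 0) \<Longrightarrow> w = 0"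
    and G: "\<And>q b c. q \<in> S \<Longrightarrow> (\<lambda>q. G q b c) differentiable at q"
    and r: "\<And>y. (\<lambda>q. r q y) differentiable at z"
    and w: "\<And>q y. q \<in> S \<Longrightarrow> G q (w q) y = r q y"
  shows "w differentiable at z"
proof -
  define \<Phi> where "\<Phi> = (\<lambda>(q, w). (q, \<Sum>b\<in>Basis. (\<Sum>c\<in>Basis. (w \<bullet> c) * G q c b) *\<^sub>R b))"
  have \<Phi>: "\<Phi> (q, w) = (q, form_map (G q) w)" if "q \<in> S" for q w
    unfolding \<Phi>_def form_map_def by (simp add: bilinear_expand_left[OF bil[OF that], of w])
  define D where "D = (\<lambda>c b. frechet_derivative (\<lambda>q. G q c b) (at z))"
  define C where "C = (\<lambda>h. \<Sum>b\<in>Basis. (\<Sum>c\<in>Basis. (w z \<bullet> c) * D c b h) *\<^sub>R b)"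
  define D\<Phi> where "D\<Phi> = (\<lambda>(h, k). (h, form_map (G z) k + C h))"
  have GD: "((\<lambda>q. G q c b) has_derivative D c b) (at z)" for c b
    unfolding D_def using G[OF S(2)] by (rule differentiable_imp_has_frechet)
  have GD': "((\<lambda>p. G (fst p) c b) has_derivative (\<lambda>v. D c b (fst v))) (at (z, w z))" for c b
    by (rule has_derivative_compose[OF has_derivative_fst[OF has_derivative_ident]]) (simp add: GD)
  have der: "(\<Phi> has_derivative D\<Phi>) (at (z, w z))"
  proof -
    have eq: "\<Phi> = (\<lambda>p. (fst p, \<Sum>b\<in>Basis. (\<Sum>c\<in>Basis. (snd p \<bullet> c) * G (fst p) c b) *\<^sub>R b))"
      by (auto simp: \<Phi>_def)
    have fm: "form_map (G z) k = (\<Sum>b\<in>Basis. (\<Sum>c\<in>Basis. (k \<bullet> c) * G z c b) *\<^sub>R b)" for k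
      using \<Phi>[OF S(2), of k] by (simp add: \<Phi>_def)
    have "((\<lambda>p. (snd p \<bullet> c) * G (fst p) c b) has_derivative
        (\<lambda>h. (w z \<bullet> c) * D c b (fst h) + (snd h \<bullet> c) * G z c b)) (at (z, w z))" for c b
      using has_derivative_mult[OF has_derivative_inner_left[OF has_derivative_snd[OF has_derivative_ident]] GD']
      by simp
    then have "(\<Phi> has_derivative (\<lambda>h. (fst h, \<Sum>b\<in>Basis.
        (\<Sum>c\<in>Basis. (w z \<bullet> c) * D c b (fst h) + (snd h \<bullet> c) * G z c b) *\<^sub>R b))) (at (z, w z))"
      unfolding eq
      by (intro has_derivative_Pair has_derivative_fst[OF has_derivative_ident] has_derivative_sum
        has_derivative_scaleR_left)
    moreover have "(\<lambda>h. (fst h, \<Sum>b\<in>Basis.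
        (\<Sum>c\<in>Basis. (w z \<bullet> c) * D c b (fst h) + (snd h \<bullet> c) * G z c b) *\<^sub>R b)) = D\<Phi>"
      by (simp add: D\<Phi>_def fm C_def fun_eq_iff sum.distrib scaleR_left_distrib add.commute)
    ultimately show ?thesis by simp
  qed
  have cont: "continuous_on (S \<times> UNIV) \<Phi>"
  proof -
    have "continuous_on S (\<lambda>q. G q c b)" for c b
      by (rule continuous_at_imp_continuous_on) (simp add: G differentiable_imp_continuous_within)
    then have "continuous_on (S \<times> UNIV) (\<lambda>p. G (fst p) c b)" for c b
      by (rule continuous_on_compose2[OF _ continuous_on_fst[OF continuous_on_id]]) auto
    then show ?thesis unfolding \<Phi>_def case_prod_unfold by (intro continuous_intros)
  qed
  have bij: "bij (form_map (G q))" if "q \<in> S" for q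
    by (rule bij_form_map[OF bil[OF that] nondeg[OF that]])
  have inj: "inj_on \<Phi> (S \<times> UNIV)"
  proof (rule inj_onI)
    fix p p' assume p: "p \<in> S \<times> UNIV" and p': "p' \<in> S \<times> UNIV" and eq: "\<Phi> p = \<Phi> p'"
    obtain q w q' w' where [simp]: "p = (q, w)" "p' = (q', w')" by fastforce
    have "q \<in> S" "q' = q" "form_map (G q) w = form_map (G q) w'"
      using p p' eq by (auto simp: \<Phi>)
    then show "p = p'" using bij_is_inj[OF bij] by (simp add: inj_eq)
  qed
  define \<Psi> where "\<Psi> = inv_into (S \<times> UNIV) \<Phi>"
  have \<Psi>: "\<Psi> (\<Phi> p) = p" if "p \<in> S \<times> UNIV" for p
    unfolding \<Psi>_def using that inj by simp
  define D\<Psi> where "D\<Psi> = (\<lambda>(h, k). (h, inv (form_map (G z)) (k - C h)))"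
  have id: "D\<Phi> \<circ> D\<Psi> = id"
    using surj_f_inv_f[OF bij_is_surj[OF bij[OF S(2)]]] by (simp add: D\<Phi>_def D\<Psi>_def fun_eq_iff)
  have der\<Psi>: "(\<Psi> has_derivative D\<Psi>) (at (\<Phi> (z, w z)))"
    by (rule has_derivative_inverse_strong[OF _ _ cont \<Psi> der id])
      (simp_all add: open_Times S)
  define R where "R = (\<lambda>q. (q, \<Sum>b\<in>Basis. r q b *\<^sub>R b))"
  have R: "R q = \<Phi> (q, w q)" if "q \<in> S" for q
    using w[OF that] \<Phi>[OF that] by (simp add: R_def form_map_def)
  have "(R has_derivative (\<lambda>h. (h, \<Sum>b\<in>Basis. frechet_derivative (\<lambda>q. r q b) (at z) h *\<^sub>R b))) (at z)"
    unfolding R_def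
    by (rule has_derivative_Pair[OF has_derivative_ident has_derivative_sum[OF
      has_derivative_scaleR_left[OF differentiable_imp_has_frechet[OF r]]]])
  moreover have "(\<Psi> has_derivative D\<Psi>) (at (R z))"
    using der\<Psi> R[OF S(2)] by simp
  ultimately have "(\<Psi> \<circ> R has_derivative D\<Psi> \<circ>
      (\<lambda>h. (h, \<Sum>b\<in>Basis. frechet_derivative (\<lambda>q. r q b) (at z) h *\<^sub>R b))) (at z)"
    by (rule diff_chain_at)
  from differentiableI[OF has_derivative_snd[OF this]]
  have 2: "(\<lambda>q. snd ((\<Psi> \<circ> R) q)) differentiable at z" .
  show ?thesis
    by (rule differentiable_cong_open[OF 2 S]) (simp add: R \<Psi>)
qed

text \<open>The coordinate expression of a smooth metric on the range of a chart.\<close>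

locale chart_metric_on =
  fixes S :: "'e::euclidean_space set" and G :: "'e \<Rightarrow> 'e \<Rightarrow> 'e \<Rightarrow> real"
  assumes open_S: "open S"
    and bilinear_G: "q \<in> S \<Longrightarrow> bilinear (G q)"
    and nondegenerate: "q \<in> S \<Longrightarrow> (\<And>y. G q w y = 0) \<Longrightarrow> w = 0"
    and smooth_G: "smooth_on S (\<lambda>q. G q u v)"
begin

lemma metric_cancel:
  assumes "q \<in> S" "\<And>y. G q w' y = G q w y"
  shows "w' = w"
  using nondegenerate[OF assms(1), of "w' - w"] bilinear_lsub[OF bilinear_G[OF assms(1)]] assms(2)
  by simp

lemma has_derivative_G:
  "q \<in> S \<Longrightarrow> ((\<lambda>q. G q u v) has_derivative frechet_derivative (\<lambda>q. G q u v) (at q)) (at q)"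
  by (rule differentiable_imp_has_frechet[OF smooth_on_differentiable[OF smooth_G]])

lemma linear_koszul:
  assumes "z \<in> S"
  shows "linear (koszul G z u v)"
proof -
  have add: "frechet_derivative (\<lambda>q. G q a (y + y')) (at z) =
      (\<lambda>h. frechet_derivative (\<lambda>q. G q a y) (at z) h + frechet_derivative (\<lambda>q. G q a y') (at z) h)"
    for a y y'
  proof -
    have "frechet_derivative (\<lambda>q. G q a (y + y')) (at z)
        = frechet_derivative (\<lambda>q. G q a y + G q a y') (at z)"
      using assms open_S bilinear_radd[OF bilinear_G] by (intro frechet_derivative_cong_open[of S]) auto
    then show ?thesis
      using frechet_derivative_at[OF has_derivative_add[OF has_derivative_G[OF assms] has_derivative_G[OF assms]]]
      by simp
  qed
  have mul: "frechet_derivative (\<lambda>q. G q a (s *\<^sub>R y)) (at z) =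
      (\<lambda>h. s * frechet_derivative (\<lambda>q. G q a y) (at z) h)" for a s y
  proof -
    have "frechet_derivative (\<lambda>q. G q a (s *\<^sub>R y)) (at z)
        = frechet_derivative (\<lambda>q. s * G q a y) (at z)"
      using assms open_S bilinear_rmul[OF bilinear_G] by (intro frechet_derivative_cong_open[of S]) auto
    then show ?thesis
      using frechet_derivative_at[OF has_derivative_mult_right[OF has_derivative_G[OF assms]]] by simp
  qed
  have lin: "linear (frechet_derivative (\<lambda>q. G q u v) (at z))"
    using has_derivative_G[OF assms] by (rule has_derivative_linear)
  show ?thesis
    by (rule linearI)
      (simp_all add: koszul_def add mul linear_add[OF lin] linear_cmul[OF lin] algebra_simps)
qed

text \<open>This turns the definite description of \<open>christoffel\<close> into its defining equation. The Koszul
  expression is linear in \<open>y\<close>, so a nondegenerate form represents it by a unique vector.\<close>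

lemma christoffel_koszul:
  assumes "z \<in> S"
  shows "2 * G z (christoffel G z u v) y = koszul G z u v y"
proof -
  have "surj (form_map (G z))"
    using bij_form_map[OF bilinear_G[OF assms]] nondegenerate[OF assms] by (auto simp: bij_def)
  then obtain w where w: "form_map (G z) w = (\<Sum>b\<in>Basis. (koszul G z u v b / 2) *\<^sub>R b)"
    by (metis surjD)
  have *: "2 * G z w y = koszul G z u v y" for y
  proof -
    have "2 * G z w y = 2 * (form_map (G z) w \<bullet> y)"
      by (simp add: form_map_inner[OF bilinear_G[OF assms]])
    also have "\<dots> = (\<Sum>b\<in>Basis. (y \<bullet> b) * koszul G z u v b)"
      by (simp add: w inner_sum_left sum_distrib_left) (simp add: inner_commute mult.commute)
    finally show ?thesis using linear_expand[OF linear_koszul[OF assms], of u v y] by simp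
  qed
  then have "christoffel G z u v = w"
    by (rule christoffel_eqI) (use metric_cancel[OF assms] in blast)
  then show ?thesis using * by simp
qed

text \<open>The curvature differentiates Christoffel symbols, and \<open>frechet_derivative\<close> obeys the rules of
  calculus only where the derivative exists.\<close>

lemma differentiable_christoffel:
  assumes "z \<in> S"
  shows "(\<lambda>q. christoffel G q u v) differentiable at z"
proof (rule nondegenerate_solution_differentiable[OF open_S assms bilinear_G nondegenerate])
  show "(\<lambda>q. G q b c) differentiable at q" if "q \<in> S" for q b c
    using that smooth_G by (rule smooth_on_differentiable[rotated])
  show "G q (christoffel G q u v) y = koszul G q u v y / 2" if "q \<in> S" for q y
    using christoffel_koszul[OF that, of u v y] by simp
  show "(\<lambda>q. koszul G q u v y / 2) differentiable at z" for y
  proof -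
    have "(\<lambda>q. frechet_derivative (\<lambda>q. G q a b) (at q) c) differentiable at z" for a b c
      using smooth_on_differentiable[OF smooth_on_frechet_derivative[OF smooth_G] assms] .
    then have "(\<lambda>q. koszul G q u v y) differentiable at z"
      unfolding koszul_def by (intro differentiable_add differentiable_diff)
    then show ?thesis by (auto intro: differentiable_divide simp: differentiable_const)
  qed
qed auto

lemma christoffel_zero_left:
  assumes "z \<in> S"
  shows "christoffel G z 0 v = 0"
proof (rule christoffel_eqI)
  have "frechet_derivative (\<lambda>q. G q 0 y) (at z) = frechet_derivative (\<lambda>q. 0::real) (at z)" for y
    using assms open_S bilinear_lzero[OF bilinear_G] by (intro frechet_derivative_cong_open[of S]) auto
  moreover have "frechet_derivative (\<lambda>q. G q v y) (at z) 0 = 0" for y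
    using linear_0[OF has_derivative_linear[OF has_derivative_G[OF assms]]] .
  ultimately show "2 * G z 0 y = koszul G z 0 v y" for y
    using bilinear_lzero[OF bilinear_G[OF assms]] by (simp add: koszul_def)
  show "w = 0" if "\<And>y. G z w y = G z 0 y" for w using metric_cancel[OF assms that] .
qed

end


section \<open>Static metrics in a chart\<close>

lemma cov_deriv_const: "cov_deriv G (\<lambda>_. u) (\<lambda>_. v) z = christoffel G z u v"
  by (simp add: cov_deriv_def)

text \<open>The bracket term drops out because coordinate fields commute; the hypothesis says that the
  covariant derivative along the zero field vanishes.\<close>

lemma curvature_coordinate_fields:
  assumes "christoffel G z 0 w = 0"
  shows "curvature G (\<lambda>_. u) (\<lambda>_. v) (\<lambda>_. w) z =
    frechet_derivative (\<lambda>q. christoffel G q v w) (at z) u + christoffel G z u (christoffel G z v w)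
    - (frechet_derivative (\<lambda>q. christoffel G q u w) (at z) v
      + christoffel G z v (christoffel G z u w))"
proof -
  have c: "cov_deriv G (\<lambda>_. a) (\<lambda>_. b) = (\<lambda>q. christoffel G q a b)" for a b
    by (rule ext) (rule cov_deriv_const)
  have d: "cov_deriv G (\<lambda>_. a) Y z = frechet_derivative Y (at z) a + christoffel G z a (Y z)" for a Y
    by (simp add: cov_deriv_def)
  have "cov_deriv G (lie_bracket (\<lambda>_. u) (\<lambda>_. v)) (\<lambda>_. w) z = 0"
    using assms by (simp add: cov_deriv_def lie_bracket_def)
  then show ?thesis
    by (simp add: curvature_def c d)
qed

lemma chart_hessian_christoffel:
  "chart_hessian G F z u v =
    frechet_derivative (\<lambda>q. frechet_derivative F (at q) v) (at z) u
    - frechet_derivative F (at z) (christoffel G z u v)"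
  by (simp add: chart_hessian_def cov_deriv_const)

lemma chart_hessian_cong:
  assumes S: "open S" "z \<in> S" and eq: "\<And>q. q \<in> S \<Longrightarrow> F q = F' q"
  shows "chart_hessian G F z u v = chart_hessian G F' z u v"
proof -
  have D: "frechet_derivative F (at q) = frechet_derivative F' (at q)" if "q \<in> S" for q
    by (rule frechet_derivative_cong_open[OF S(1) that eq])
  have "frechet_derivative (\<lambda>q. frechet_derivative F (at q) v) (at z)
      = frechet_derivative (\<lambda>q. frechet_derivative F' (at q) v) (at z)"
    by (rule frechet_derivative_cong_open[OF S]) (simp add: D)
  then show ?thesis by (simp add: chart_hessian_def D[OF S(2)])
qed

text \<open>The static metric \<open>G - f\<^sup>2 dt\<^sup>2\<close> over the range of a chart. The identity for \<open>H\<close> is demanded over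
  \<open>S\<close> only, as a chart metric is meaningless off the range of its chart.\<close>

locale static_chart = chart_metric_on S G
  for S :: "'e::euclidean_space set" and G :: "'e \<Rightarrow> 'e \<Rightarrow> 'e \<Rightarrow> real" +
  fixes f :: "'e \<Rightarrow> real" and H :: "'e \<times> real \<Rightarrow> 'e \<times> real \<Rightarrow> 'e \<times> real \<Rightarrow> real"
  assumes smooth_f: "smooth_on S f"
    and f_nonzero: "q \<in> S \<Longrightarrow> f q \<noteq> 0"
    and H: "q \<in> S \<Longrightarrow> H (q, t) (u, a) (v, b) = G q u v - (f q)\<^sup>2 * (a * b)"
begin

abbreviation Df :: "'e \<Rightarrow> 'e \<Rightarrow> real" where "Df q \<equiv> frechet_derivative f (at q)"

lemma open_cylinder: "open (S \<times> (UNIV :: real set))"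
  by (simp add: open_Times open_S)

lemma has_derivative_f: "q \<in> S \<Longrightarrow> (f has_derivative Df q) (at q)"
  by (rule differentiable_imp_has_frechet[OF smooth_on_differentiable[OF smooth_f]])

lemma linear_Df: "q \<in> S \<Longrightarrow> linear (Df q)"
  using has_derivative_f by (rule has_derivative_linear)

lemma frechet_derivative_H:
  assumes z: "z \<in> S"
  shows "frechet_derivative (\<lambda>p. H p (u, a) (v, b)) (at (z, t)) (w, c) =
    frechet_derivative (\<lambda>q. G q u v) (at z) w - 2 * f z * Df z w * (a * b)"
proof -
  have eq: "frechet_derivative (\<lambda>p. H p (u, a) (v, b)) (at (z, t)) =
    frechet_derivative (\<lambda>p. G (fst p) u v - (f (fst p))\<^sup>2 * (a * b)) (at (z, t))"
    by (rule frechet_derivative_cong_open[OF open_cylinder]) (auto simp: z H)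
  have "((\<lambda>q. G q u v - (f q)\<^sup>2 * (a * b)) has_derivative
      (\<lambda>w. frechet_derivative (\<lambda>q. G q u v) (at z) w - 2 * f z * Df z w * (a * b))) (at z)"
    by (rule has_derivative_eq_rhs,
        (rule derivative_intros has_derivative_G[OF z] has_derivative_f[OF z])+) (simp add: fun_eq_iff)
  from has_derivative_fst_compose[OF this, of t] show ?thesis
    by (simp add: eq frechet_derivative_at[symmetric])
qed

text \<open>For arbitrary \<open>a\<close> and \<open>b\<close> the first component would contain the further term \<open>a b f grad f\<close>. It
  vanishes when one of the two fields is horizontal, and only such pairs occur in \<open>R(w,u)v\<close> with
  horizontal \<open>u\<close> and \<open>v\<close>.\<close>

lemma christoffel_H:
  assumes z: "z \<in> S" and ab: "a * b = 0"
  shows "christoffel H (z, t) (u, a) (v, b) =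
    (christoffel G z u v, (Df z u * b + Df z v * a) / f z)"
proof (rule christoffel_eqI)
  fix y :: "'e \<times> real"
  obtain y1 c where y: "y = (y1, c)" by fastforce
  have "2 * G z (christoffel G z u v) y1 = koszul G z u v y1"
    using christoffel_koszul[OF z] .
  \<comment> \<open>the vertical part of \<open>y\<close> pairs with the derivatives of \<open>f\<^sup>2\<close> in the Koszul formula\<close>
  moreover have "2 * (f z)\<^sup>2 * ((Df z u * b + Df z v * a) / f z * c) = 2 * f z * (Df z u * b + Df z v * a) * c"
    using f_nonzero[OF z] by (simp add: power2_eq_square)
  ultimately show "2 * H (z, t) (christoffel G z u v, (Df z u * b + Df z v * a) / f z) y
      = koszul H (z, t) (u, a) (v, b) y"
    using ab by (auto simp add: y koszul_def frechet_derivative_H[OF z] H[OF z] algebra_simps)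
next
  fix w' assume *: "\<And>y. H (z, t) w' y = H (z, t) (christoffel G z u v, (Df z u * b + Df z v * a) / f z) y"
  obtain w1 c where w: "w' = (w1, c)" by fastforce
  have "w1 = christoffel G z u v"
    using *[of "(_, 0)"] by (intro metric_cancel[OF z]) (simp add: w H[OF z])
  moreover have "(f z)\<^sup>2 * c = (f z)\<^sup>2 * ((Df z u * b + Df z v * a) / f z)"
    using *[of "(0, 1)"] bilinear_rzero[OF bilinear_G[OF z]] by (simp add: w H[OF z])
  then have "c = (Df z u * b + Df z v * a) / f z"
    using f_nonzero[OF z] by (simp only: mult_cancel_left power_eq_0_iff) simp
  ultimately show "w' = (christoffel G z u v, (Df z u * b + Df z v * a) / f z)" by (simp add: w)
qed

lemma christoffel_H_zero_left: "z \<in> S \<Longrightarrow> christoffel H (z, t) 0 (v, 0) = 0"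
  using christoffel_H[of z 0 0 t 0 v] by (simp add: zero_prod_def christoffel_zero_left)

lemma frechet_derivative_christoffel_horizontal:
  assumes z: "z \<in> S"
  shows "frechet_derivative (\<lambda>p. christoffel H p (u, 0) (v, 0)) (at (z, t)) (w, c) =
    (frechet_derivative (\<lambda>q. christoffel G q u v) (at z) w, 0)"
proof -
  have eq: "frechet_derivative (\<lambda>p. christoffel H p (u, 0) (v, 0)) (at (z, t)) =
      frechet_derivative (\<lambda>p. (christoffel G (fst p) u v, 0)) (at (z, t))"
    by (rule frechet_derivative_cong_open[OF open_cylinder]) (auto simp: z christoffel_H)
  have "((\<lambda>q. (christoffel G q u v, 0::real)) has_derivative
      (\<lambda>w. (frechet_derivative (\<lambda>q. christoffel G q u v) (at z) w, 0))) (at z)"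
    by (rule has_derivative_Pair[OF differentiable_imp_has_frechet[OF differentiable_christoffel[OF z]]
        has_derivative_const])
  from has_derivative_fst_compose[OF this, of t] show ?thesis
    by (simp add: eq frechet_derivative_at[symmetric])
qed

lemma frechet_derivative_christoffel_vertical:
  assumes z: "z \<in> S"
  shows "frechet_derivative (\<lambda>p. christoffel H p (0, 1) (v, 0)) (at (z, t)) (w, c) =
    (0, frechet_derivative (\<lambda>q. Df q v) (at z) w / f z - Df z v * Df z w / (f z)\<^sup>2)"
proof -
  have eq: "frechet_derivative (\<lambda>p. christoffel H p (0, 1) (v, 0)) (at (z, t)) =
      frechet_derivative (\<lambda>p. (0, Df (fst p) v / f (fst p))) (at (z, t))"
    by (rule frechet_derivative_cong_open[OF open_cylinder])
      (auto simp: z christoffel_H christoffel_zero_left)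
  have "((\<lambda>q. Df q v) has_derivative frechet_derivative (\<lambda>q. Df q v) (at z)) (at z)"
    by (rule differentiable_imp_has_frechet[OF smooth_on_differentiable[OF
        smooth_on_frechet_derivative[OF smooth_f] z]])
  from has_derivative_divide'[OF this has_derivative_f[OF z] f_nonzero[OF z]]
  have "((\<lambda>q. Df q v / f q) has_derivative
      (\<lambda>w. frechet_derivative (\<lambda>q. Df q v) (at z) w / f z - Df z v * Df z w / (f z)\<^sup>2)) (at z)"
    by (rule has_derivative_eq_rhs)
      (use f_nonzero[OF z] in \<open>simp add: fun_eq_iff field_simps power2_eq_square\<close>)
  from has_derivative_fst_compose[OF has_derivative_Pair[OF has_derivative_const this], of "0::'e" t]
  show ?thesis
    by (simp add: eq frechet_derivative_at[symmetric])
qed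

text \<open>The trace splits into the horizontal basis vectors, on which the curvature is that of \<open>G\<close>, and the
  vertical one. For the latter, \<open>\<Gamma>(\<partial>\<^sub>t, v) = (v f / f) \<partial>\<^sub>t\<close>, so that the vertical part of
  \<open>R(\<partial>\<^sub>t, u)v\<close> is \<open>(\<Gamma>(u,v) f - u v f) / f\<close>; the terms with products of first derivatives of \<open>f\<close>
  cancel.\<close>

lemma chart_ricci_H:
  assumes z: "z \<in> S"
  shows "chart_ricci H (z, t) (u, 0) (v, 0) = chart_ricci G z u v - chart_hessian G f z u v / f z"
proof -
  note R = curvature_coordinate_fields[OF christoffel_H_zero_left[OF z]]
  have hor: "curvature H (\<lambda>_. (b, 0)) (\<lambda>_. (u, 0)) (\<lambda>_. (v, 0)) (z, t) \<bullet> (b, 0)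
      = curvature G (\<lambda>_. b) (\<lambda>_. u) (\<lambda>_. v) z \<bullet> b" for b
    by (simp add: R curvature_coordinate_fields[OF christoffel_zero_left[OF z]] christoffel_H[OF z]
        frechet_derivative_christoffel_horizontal[OF z])
  have ver: "curvature H (\<lambda>_. (0, 1)) (\<lambda>_. (u, 0)) (\<lambda>_. (v, 0)) (z, t) \<bullet> (0, 1)
      = - (chart_hessian G f z u v / f z)"
    using f_nonzero[OF z] linear_0[OF linear_Df[OF z]]
    by (simp add: R christoffel_H[OF z] christoffel_zero_left[OF z] chart_hessian_christoffel
        frechet_derivative_christoffel_horizontal[OF z] frechet_derivative_christoffel_vertical[OF z]
        field_simps power2_eq_square)
  have "(Basis :: ('e \<times> real) set) = (\<lambda>b. (b, 0)) ` Basis \<union> {(0, 1)}"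
    by (simp add: Basis_prod_def)
  then have "chart_ricci H (z, t) (u, 0) (v, 0) =
      (\<Sum>b\<in>(\<lambda>b. (b, 0)) ` Basis \<union> {(0, 1)}. curvature H (\<lambda>_. b) (\<lambda>_. (u, 0)) (\<lambda>_. (v, 0)) (z, t) \<bullet> b)"
    by (simp add: chart_ricci_def)
  also have "\<dots> = (\<Sum>b\<in>Basis. curvature H (\<lambda>_. (b, 0)) (\<lambda>_. (u, 0)) (\<lambda>_. (v, 0)) (z, t) \<bullet> (b, 0))
      + curvature H (\<lambda>_. (0, 1)) (\<lambda>_. (u, 0)) (\<lambda>_. (v, 0)) (z, t) \<bullet> (0, 1)"
    by (subst sum.union_disjoint) (auto simp: sum.reindex inj_on_def)
  finally show ?thesis by (simp only: hor ver chart_ricci_def)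
qed

text \<open>The slice is totally geodesic: by \<open>christoffel_H\<close> covariant derivatives of horizontal fields are
  horizontal. Hence Hessians restrict to it.\<close>

lemma chart_hessian_H:
  assumes z: "z \<in> S" and F: "smooth_on (S \<times> UNIV) F"
  shows "chart_hessian H F (z, t) (u, 0) (v, 0) = chart_hessian G (\<lambda>q. F (q, t)) z u v"
proof -
  have slice: "frechet_derivative (\<lambda>q. F' (q, t)) (at q) w = frechet_derivative F' (at (q, t)) (w, 0)"
    if "F' differentiable at (q, t)" for F' :: "'e \<times> real \<Rightarrow> real" and q w
  proof -
    have "bounded_linear (\<lambda>q::'e. (q, 0::real))"
      by (intro bounded_linear_Pair bounded_linear_ident bounded_linear_zero)
    from frechet_derivative_affine_compose[OF this, of F' q "(0, t)"] that show ?thesis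
      by (simp add: frechet_derivative_at[symmetric])
  qed
  have F': "F differentiable at (q, t)" if "q \<in> S" for q
    using that by (intro smooth_on_differentiable[OF F]) simp
  have "frechet_derivative (\<lambda>q. frechet_derivative (\<lambda>q. F (q, t)) (at q) v) (at z) u =
    frechet_derivative (\<lambda>q. frechet_derivative F (at (q, t)) (v, 0)) (at z) u"
    by (rule arg_cong[OF frechet_derivative_cong_open[OF open_S z], where f = "\<lambda>D. D u"])
      (rule slice[OF F'])
  also have "\<dots> = frechet_derivative (\<lambda>p. frechet_derivative F (at p) (v, 0)) (at (z, t)) (u, 0)"
    by (rule slice[where F' = "\<lambda>p. frechet_derivative F (at p) (v, 0)"],
        rule smooth_on_differentiable[OF smooth_on_frechet_derivative[OF F]]) (simp add: z)
  finally show ?thesis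
    by (simp add: chart_hessian_christoffel slice[OF F'[OF z]] christoffel_H[OF z])
qed

end


section \<open>Coordinate vectors on a manifold\<close>

lemma
  assumes "smooth_atlas A" "(U, x) \<in> A"
  shows chart_open: "open U" "open (x ` U)"
    and chart_inverse: "p \<in> U \<Longrightarrow> inv_into U x (x p) = p"
    and chart_inj_on: "inj_on x U"
    and chart_open_image: "open W \<Longrightarrow> open (x ` (U \<inter> W))"
proof -
  have o: "open U" "open (x ` U)" and hom: "homeomorphism U (x ` U) x (inv_into U x)"
    using assms unfolding smooth_atlas_def by auto
  show "open U" "open (x ` U)" by (fact o)+
  show inv: "inv_into U x (x p) = p" if "p \<in> U" for p
    using hom that by (simp add: homeomorphism_def)
  show "inj_on x U" by (rule inj_on_inverseI) (rule inv)
  show "open (x ` (U \<inter> W))" if "open W"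
    using homeomorphism_imp_open_map[OF hom openin_open_Int[OF that]] openin_open_trans o(2) by blast
qed

lemma smooth_nearE:
  assumes "h \<in> smooth_near A p"
  obtains W where "open W" "p \<in> W" "\<And>U x. (U, x) \<in> A \<Longrightarrow> smooth_on (x ` (U \<inter> W)) (h \<circ> inv_into U x)"
  using assms unfolding smooth_near_def smooth_fun_on_def by blast

lemma smooth_nearI:
  assumes "open W" "p \<in> W" "\<And>U x. (U, x) \<in> A \<Longrightarrow> smooth_on (x ` (U \<inter> W)) (h \<circ> inv_into U x)"
  shows "h \<in> smooth_near A p"
  using assms unfolding smooth_near_def smooth_fun_on_def by blast

lemma smooth_near_binop:
  fixes A :: "('m::{t2_space,second_countable_topology}, 'e::euclidean_space) chart set"
  assumes A: "smooth_atlas A" and h: "h \<in> smooth_near A p" and k: "k \<in> smooth_near A p"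
    and b: "\<And>(S :: 'e set) F G. smooth_on S F \<Longrightarrow> smooth_on S G \<Longrightarrow> open S \<Longrightarrow>
      smooth_on S (\<lambda>z. b (F z) (G z))"
  shows "(\<lambda>q. b (h q) (k q)) \<in> smooth_near A p"
proof -
  obtain V where V: "open V" "p \<in> V" "\<And>U x. (U, x) \<in> A \<Longrightarrow> smooth_on (x ` (U \<inter> V)) (h \<circ> inv_into U x)"
    using smooth_nearE[OF h] by metis
  obtain W where W: "open W" "p \<in> W" "\<And>U x. (U, x) \<in> A \<Longrightarrow> smooth_on (x ` (U \<inter> W)) (k \<circ> inv_into U x)"
    using smooth_nearE[OF k] by metis
  show ?thesis
  proof (rule smooth_nearI[of "V \<inter> W"])
    show "open (V \<inter> W)" "p \<in> V \<inter> W" using V W by auto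
    fix U x assume c: "(U, x) \<in> A"
    have "smooth_on (x ` (U \<inter> (V \<inter> W))) (h \<circ> inv_into U x)"
      by (rule smooth_on_subset[OF V(3)[OF c]]) blast
    moreover have "smooth_on (x ` (U \<inter> (V \<inter> W))) (k \<circ> inv_into U x)"
      by (rule smooth_on_subset[OF W(3)[OF c]]) blast
    moreover have "open (x ` (U \<inter> (V \<inter> W)))"
      using V W by (intro chart_open_image[OF A c]) auto
    ultimately show "smooth_on (x ` (U \<inter> (V \<inter> W))) ((\<lambda>q. b (h q) (k q)) \<circ> inv_into U x)"
      using b by (simp add: o_def)
  qed
qed

lemma smooth_near_const: "(\<lambda>_. a) \<in> smooth_near A p"
  by (rule smooth_nearI[of UNIV]) (auto simp: o_def smooth_on_const)

lemma smooth_near_differentiable: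
  assumes "smooth_atlas A" "(U, x) \<in> A" "p \<in> U" "h \<in> smooth_near A p"
  shows "(h \<circ> inv_into U x) differentiable at (x p)"
proof -
  obtain W where "p \<in> W" "smooth_on (x ` (U \<inter> W)) (h \<circ> inv_into U x)"
    using smooth_nearE[OF assms(4)] assms(2) by metis
  then show ?thesis using assms(3) by (auto intro: smooth_on_differentiable)
qed

text \<open>The derivation rules are those of \<open>frechet_derivative\<close>. Besides them one needs that sums and
  products stay in \<open>smooth_near A p\<close>, outside of which a coordinate vector is set to \<open>0\<close>.\<close>

lemma coord_vector_in_tangent_space:
  assumes A: "smooth_atlas A" and c: "(U, x) \<in> A" and p: "p \<in> U"
  shows "coord_vector A (U, x) p v \<in> tangent_space A p"
proof -
  have D: "(h \<circ> inv_into U x has_derivative frechet_derivative (h \<circ> inv_into U x) (at (x p))) (at (x p))"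
    if "h \<in> smooth_near A p" for h
    by (rule differentiable_imp_has_frechet[OF smooth_near_differentiable[OF A c p that]])
  have add: "coord_vector A (U, x) p v (\<lambda>q. h q + k q)
      = coord_vector A (U, x) p v h + coord_vector A (U, x) p v k"
    if "h \<in> smooth_near A p" "k \<in> smooth_near A p" for h k
  proof -
    have "(\<lambda>q. h q + k q) \<in> smooth_near A p"
      by (rule smooth_near_binop[OF A that smooth_on_add])
    with frechet_derivative_at[OF has_derivative_add[OF D[OF that(1)] D[OF that(2)]]] that
    show ?thesis by (simp add: coord_vector_def o_def fun_eq_iff)
  qed
  have mult: "(\<lambda>q. h q * k q) \<in> smooth_near A p \<and> coord_vector A (U, x) p v (\<lambda>q. h q * k q)
      = coord_vector A (U, x) p v h * k p + h p * coord_vector A (U, x) p v k"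
    if "h \<in> smooth_near A p" "k \<in> smooth_near A p" for h k
  proof -
    have "(\<lambda>q. h q * k q) \<in> smooth_near A p"
      by (rule smooth_near_binop[OF A that smooth_on_mult])
    with frechet_derivative_at[OF has_derivative_mult[OF D[OF that(1)] D[OF that(2)]]] that
    show ?thesis
      by (simp add: coord_vector_def o_def fun_eq_iff chart_inverse[OF A c p] add.commute)
  qed
  have const: "coord_vector A (U, x) p v (\<lambda>_. a) = 0" for a
    by (simp add: coord_vector_def o_def)
  have "coord_vector A (U, x) p v (\<lambda>q. a * h q) = a * coord_vector A (U, x) p v h"
    if "h \<in> smooth_near A p" for a h
    using mult[OF smooth_near_const[of a] that] by (simp add: const)
  then show ?thesis
    using add mult by (simp add: tangent_space_def) (simp add: coord_vector_def)
qed

lemma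
  assumes A: "smooth_atlas A" and c: "(U, x) \<in> A" and p: "p \<in> U"
  shows coord_vector_add: "coord_vector A (U, x) p (u + v) =
      (\<lambda>h. coord_vector A (U, x) p u h + coord_vector A (U, x) p v h)"
    and coord_vector_scaleR: "coord_vector A (U, x) p (a *\<^sub>R v) =
      (\<lambda>h. a * coord_vector A (U, x) p v h)"
  using linear_frechet_derivative[OF smooth_near_differentiable[OF A c p]]
  by (simp_all add: coord_vector_def fun_eq_iff linear_add linear_cmul)

text \<open>The coordinate function \<open>q \<mapsto> x q \<bullet> v\<close> is a test function that detects \<open>v\<close>. It is smooth in every chart
  because the coordinate changes are.\<close>

lemma coord_vector_nonzero:
  assumes A: "smooth_atlas A" and c: "(U, x) \<in> A" and p: "p \<in> U" and v: "v \<noteq> 0"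
  shows "coord_vector A (U, x) p v \<noteq> (\<lambda>_. 0)"
proof -
  let ?h = "\<lambda>q. x q \<bullet> v"
  have h: "?h \<in> smooth_near A p"
  proof (rule smooth_nearI[of U])
    show "open U" "p \<in> U" using chart_open[OF A c] p by auto
    fix V y assume d: "(V, y) \<in> A"
    have "smooth_on (y ` (V \<inter> U)) (x \<circ> inv_into V y)"
      using A c d unfolding smooth_atlas_def by fast
    from smooth_on_linear_compose[OF bounded_linear_inner_left this chart_open_image[OF A d chart_open(1)[OF A c]]]
    show "smooth_on (y ` (V \<inter> U)) (?h \<circ> inv_into V y)" by (simp add: o_def)
  qed
  have "frechet_derivative (?h \<circ> inv_into U x) (at (x p)) = frechet_derivative (\<lambda>z. z \<bullet> v) (at (x p))"
    by (rule frechet_derivative_cong_open[OF chart_open(2)[OF A c]])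
      (auto simp: p chart_inverse[OF A c])
  also have "\<dots> = (\<lambda>z. z \<bullet> v)"
    by (rule frechet_derivative_at[symmetric])
      (rule bounded_linear_imp_has_derivative[OF bounded_linear_inner_left])
  finally have "coord_vector A (U, x) p v ?h = v \<bullet> v"
    using h by (simp add: coord_vector_def)
  with v have "coord_vector A (U, x) p v ?h \<noteq> 0" by simp
  then show ?thesis by (rule contrapos_nn) simp
qed


section \<open>Riemannian metrics in charts\<close>

lemma chart_metric_at:
  assumes "smooth_atlas A" "(U, x) \<in> A" "p \<in> U"
  shows "chart_metric A g (U, x) (x p) u v = g p (coord_vector A (U, x) p u) (coord_vector A (U, x) p v)"
  using chart_inverse[OF assms] by (simp add: chart_metric_def)

lemma riemannian_chart_metric_pos:
  assumes R: "riemannian_manifold A g" and c: "(U, x) \<in> A" and z: "z \<in> x ` U" and v: "v \<noteq> 0"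
  shows "chart_metric A g (U, x) z v v > 0"
proof -
  have A: "smooth_atlas A" using R by (simp add: riemannian_manifold_def)
  obtain p where p: "p \<in> U" "z = x p" using z by blast
  show ?thesis
    using R coord_vector_in_tangent_space[OF A c p(1)] coord_vector_nonzero[OF A c p(1) v]
    by (simp add: riemannian_manifold_def p(2) chart_metric_at[OF A c p(1)])
qed

lemma bilinear_chart_metric:
  assumes A: "smooth_atlas A" and g: "smooth_sym_tensor A g" and c: "(U, x) \<in> A" and z: "z \<in> x ` U"
  shows "bilinear (chart_metric A g (U, x) z)"
proof -
  obtain p where p: "p \<in> U" "z = x p" using z by blast
  define e where "e = coord_vector A (U, x) p"
  have e: "e u \<in> tangent_space A p" for u
    unfolding e_def by (rule coord_vector_in_tangent_space[OF A c p(1)])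
  have G: "chart_metric A g (U, x) z u v = g p (e u) (e v)" for u v
    by (simp add: p(2) chart_metric_at[OF A c p(1)] e_def)
  have sym: "g p (e u) (e v) = g p (e v) (e u)" for u v
    using g e by (simp add: smooth_sym_tensor_def)
  have "g p (e (u + v)) (e w) = g p (e u) (e w) + g p (e v) (e w)" for u v w
    using g e[of u] e[of v] e[of w] by (simp add: e_def coord_vector_add[OF A c p(1)] smooth_sym_tensor_def)
  moreover have "g p (e (a *\<^sub>R u)) (e w) = a * g p (e u) (e w)" for a u w
    using g e[of u] e[of w] by (simp add: e_def coord_vector_scaleR[OF A c p(1)] smooth_sym_tensor_def)
  ultimately have lin: "linear (\<lambda>u. g p (e u) (e w))" for w
    by (intro linearI) auto
  show ?thesis
  proof -
    have "chart_metric A g (U, x) z u = (\<lambda>v. g p (e v) (e u))" for u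
      by (rule ext) (simp add: G sym[of u])
    then have "linear (chart_metric A g (U, x) z u)" for u
      using lin[of u] by simp
    moreover have "linear (\<lambda>u. chart_metric A g (U, x) z u v)" for v
      using lin[of v] by (simp add: G)
    ultimately show ?thesis by (simp add: bilinear_def)
  qed
qed

lemma riemannian_chart_metric_on:
  assumes R: "riemannian_manifold A g" and c: "(U, x) \<in> A"
  shows "chart_metric_on (x ` U) (chart_metric A g (U, x))"
proof
  have A: "smooth_atlas A" and g: "smooth_sym_tensor A g"
    using R by (simp_all add: riemannian_manifold_def)
  show "open (x ` U)" by (rule chart_open[OF A c])
  show "bilinear (chart_metric A g (U, x) q)" if "q \<in> x ` U" for q
    by (rule bilinear_chart_metric[OF A g c that])
  show "w = 0" if "q \<in> x ` U" "\<And>y. chart_metric A g (U, x) q w y = 0" for q w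
    using riemannian_chart_metric_pos[OF R c that(1), of w] that(2)[of w] by force
  show "smooth_on (x ` U) (\<lambda>q. chart_metric A g (U, x) q u v)" for u v
    using g c unfolding smooth_sym_tensor_def by fast
qed

lemma index_of_positive_definite:
  fixes B :: "'e::euclidean_space \<Rightarrow> 'e \<Rightarrow> real"
  assumes "\<And>v. v \<noteq> 0 \<Longrightarrow> B v v > 0"
  shows "index_of B = 0"
proof -
  have "S = {0}" if "subspace S" "\<forall>v\<in>S. v \<noteq> 0 \<longrightarrow> B v v < 0" for S
  proof -
    have "v = 0" if "v \<in> S" for v
      using \<open>\<forall>v\<in>S. v \<noteq> 0 \<longrightarrow> B v v < 0\<close> that assms[of v] by (meson less_asym)
    then show ?thesis using subspace_0[OF that(1)] by blast
  qed
  then have "(subspace S \<and> (\<forall>v\<in>S. v \<noteq> 0 \<longrightarrow> B v v < 0)) \<longleftrightarrow> S = {0}" for S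
    by (metis singletonD subspace_single_0)
  then have "{dim S |S. subspace S \<and> (\<forall>v\<in>S. v \<noteq> 0 \<longrightarrow> B v v < 0)} = {dim {0::'e}}"
    by simp
  then show ?thesis by (simp add: index_of_def)
qed

text \<open>The index is \<open>0\<close>: only the trivial subspace is negative definite.\<close>

lemma riemannian_imp_semi_riemannian:
  assumes R: "riemannian_manifold A g"
  shows "semi_riemannian_manifold A g"
proof -
  have "X = (\<lambda>_. 0)" if "X \<in> tangent_space A p" "\<forall>Y\<in>tangent_space A p. g p X Y = 0" for p X
    using R that unfolding riemannian_manifold_def by force
  moreover have "index_of (chart_metric A g (U, x) (x p)) = 0" if "(U, x) \<in> A" "p \<in> U" for U x p
    using that by (intro index_of_positive_definite riemannian_chart_metric_pos[OF R]) auto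
  ultimately show ?thesis
    using R unfolding riemannian_manifold_def semi_riemannian_manifold_def by blast
qed


section \<open>Charts of the static spacetime\<close>

abbreviation static_map :: "('m \<Rightarrow> 'e) \<Rightarrow> 'm \<times> real \<Rightarrow> 'e \<times> real" where
  "static_map x \<equiv> \<lambda>(p, t). (x p, t)"

lemma static_atlas_iff:
  "(U', x') \<in> static_atlas A \<longleftrightarrow> (\<exists>U x. (U, x) \<in> A \<and> U' = U \<times> UNIV \<and> x' = static_map x)"
  by (force simp: static_atlas_def image_iff)

lemma static_map_image: "static_map x ` (U \<times> UNIV) = x ` U \<times> UNIV"
  by (auto simp: image_iff)

text \<open>Off the range of the chart \<open>inv_into\<close> is arbitrary, so that the two sides can be compared only for
  \<open>z\<close> in the range. This is why the identities below go through congruence rules on open sets.\<close>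

lemma static_map_inverse:
  assumes A: "smooth_atlas A" and c: "(U, x) \<in> A" and z: "z \<in> x ` U"
  shows "inv_into (U \<times> UNIV) (static_map x) (z, t) = (inv_into U x z, t)"
proof -
  obtain p where p: "p \<in> U" "z = x p" using z by blast
  have "inj_on (static_map x) (U \<times> UNIV)"
    using chart_inj_on[OF A c] by (auto simp: inj_on_def)
  from inv_into_f_f[OF this, of "(p, t)"] p chart_inverse[OF A c p(1)] show ?thesis by simp
qed

lemma smooth_near_fst:
  assumes A: "smooth_atlas A" and h: "h \<in> smooth_near A p"
  shows "h \<circ> fst \<in> smooth_near (static_atlas A) (p, t)"
proof -
  obtain W where W: "open W" "p \<in> W" "\<And>U x. (U, x) \<in> A \<Longrightarrow> smooth_on (x ` (U \<inter> W)) (h \<circ> inv_into U x)"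
    using smooth_nearE[OF h] by metis
  show ?thesis
  proof (rule smooth_nearI[of "W \<times> UNIV"])
    show "open (W \<times> (UNIV::real set))" "(p, t) \<in> W \<times> UNIV" using W by (auto simp: open_Times)
    fix U' x' assume "(U', x') \<in> static_atlas A"
    then obtain U x where c: "(U, x) \<in> A" and eq: "U' = U \<times> UNIV" "x' = static_map x"
      by (auto simp: static_atlas_iff)
    have im: "x' ` (U' \<inter> W \<times> UNIV) = x ` (U \<inter> W) \<times> UNIV"
      by (simp only: eq Times_Int_Times Int_UNIV_right static_map_image)
    have op: "open (x ` (U \<inter> W) \<times> (UNIV :: real set))"
      using chart_open_image[OF A c W(1)] by (simp add: open_Times)
    have "smooth_on (x ` (U \<inter> W) \<times> (UNIV :: real set)) (\<lambda>q. (h \<circ> inv_into U x) (fst q + 0))"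
      by (rule smooth_on_affine_compose[OF bounded_linear_fst W(3)[OF c] op]) auto
    then show "smooth_on (x' ` (U' \<inter> W \<times> UNIV)) (h \<circ> fst \<circ> inv_into U' x')"
      unfolding im by (rule smooth_on_cong[OF _ op]) (auto simp: eq static_map_inverse[OF A c])
  qed
qed

lemma smooth_near_snd:
  assumes A: "smooth_atlas A"
  shows "snd \<in> smooth_near (static_atlas A) (p, t)"
proof (rule smooth_nearI[of UNIV])
  fix U' x' assume "(U', x') \<in> static_atlas A"
  then obtain U x where c: "(U, x) \<in> A" and eq: "U' = U \<times> UNIV" "x' = static_map x"
    by (auto simp: static_atlas_iff)
  have op: "open (x ` U \<times> (UNIV :: real set))"
    using chart_open[OF A c] by (simp add: open_Times)
  have "x' ` (U' \<inter> UNIV) = x ` U \<times> UNIV" by (simp only: eq Int_UNIV_right static_map_image)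
  then show "smooth_on (x' ` (U' \<inter> UNIV)) (snd \<circ> inv_into U' x')"
    using smooth_on_cong[OF smooth_on_linear[OF bounded_linear_snd] op, of "snd \<circ> inv_into U' x'"]
      static_map_inverse[OF A c] by (auto simp: eq)
qed auto

text \<open>The differential of the projection sends the coordinate vector \<open>(u, a)\<close> to \<open>u\<close>, and \<open>dt\<close> picks out
  \<open>a\<close>. Together they give the static metric its matrix in a product chart.\<close>

lemma proj_tangent_coord_vector:
  assumes A: "smooth_atlas A" and c: "(U, x) \<in> A" and p: "p \<in> U"
  shows "proj_tangent A p (coord_vector (static_atlas A) (U \<times> UNIV, static_map x) (p, t) (u, a))
    = coord_vector A (U, x) p u"
proof
  fix h
  have op: "open (x ` U \<times> (UNIV :: real set))"
    using chart_open[OF A c] by (simp add: open_Times)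
  show "proj_tangent A p (coord_vector (static_atlas A) (U \<times> UNIV, static_map x) (p, t) (u, a)) h
    = coord_vector A (U, x) p u h"
  proof (cases "h \<in> smooth_near A p")
    case True
    have "frechet_derivative (h \<circ> fst \<circ> inv_into (U \<times> UNIV) (static_map x)) (at (x p, t))
        = frechet_derivative (\<lambda>q. (h \<circ> inv_into U x) (fst q + 0)) (at (x p, t))"
      by (rule frechet_derivative_cong_open[OF op]) (auto simp: p static_map_inverse[OF A c])
    also have "\<dots> = (\<lambda>v. frechet_derivative (h \<circ> inv_into U x) (at (fst (x p, t) + 0)) (fst v))"
      by (rule frechet_derivative_at[symmetric],
          rule frechet_derivative_affine_compose[OF bounded_linear_fst])
        (simp only: fst_conv add_0_right smooth_near_differentiable[OF A c p True])
    finally show ?thesis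
      using True smooth_near_fst[OF A True] by (simp add: proj_tangent_def coord_vector_def)
  qed (simp add: proj_tangent_def coord_vector_def)
qed

lemma coord_vector_snd:
  assumes A: "smooth_atlas A" and c: "(U, x) \<in> A" and p: "p \<in> U"
  shows "coord_vector (static_atlas A) (U \<times> UNIV, static_map x) (p, t) (u, a) snd = a"
proof -
  have op: "open (x ` U \<times> (UNIV :: real set))"
    using chart_open[OF A c] by (simp add: open_Times)
  have "frechet_derivative (snd \<circ> inv_into (U \<times> UNIV) (static_map x)) (at (x p, t))
      = frechet_derivative snd (at (x p, t))"
    by (rule frechet_derivative_cong_open[OF op]) (auto simp: p static_map_inverse[OF A c])
  also have "\<dots> = snd"
    by (rule frechet_derivative_at[symmetric])
      (rule bounded_linear_imp_has_derivative[OF bounded_linear_snd])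
  finally show ?thesis using smooth_near_snd[OF A] by (simp add: coord_vector_def)
qed

lemma static_metric_coord_vector:
  assumes A: "smooth_atlas A" and c: "(U, x) \<in> A" and p: "p \<in> U"
  shows "static_metric A g f (p, t)
      (coord_vector (static_atlas A) (U \<times> UNIV, static_map x) (p, t) (u, a))
      (coord_vector (static_atlas A) (U \<times> UNIV, static_map x) (p, t) (v, b))
    = g p (coord_vector A (U, x) p u) (coord_vector A (U, x) p v) - (f p)\<^sup>2 * (a * b)"
  by (simp add: static_metric_def proj_tangent_coord_vector[OF A c p] coord_vector_snd[OF A c p])

lemma static_chart_metric:
  assumes A: "smooth_atlas A" and c: "(U, x) \<in> A" and z: "z \<in> x ` U"
  shows "chart_metric (static_atlas A) (static_metric A g f) (U \<times> UNIV, static_map x) (z, t) (u, a) (v, b)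
    = chart_metric A g (U, x) z u v - ((f \<circ> inv_into U x) z)\<^sup>2 * (a * b)"
proof -
  obtain p where p: "p \<in> U" "z = x p" using z by blast
  show ?thesis
    by (simp add: chart_metric_def static_map_inverse[OF A c z])
      (simp add: p(2) chart_inverse[OF A c p(1)] static_metric_coord_vector[OF A c p(1)])
qed

lemma static_chart_of_static_metric:
  assumes R: "riemannian_manifold A g" and c: "(U, x) \<in> A"
    and f: "smooth_fun_on A UNIV f" "\<And>p. f p \<noteq> 0"
  shows "static_chart (x ` U) (chart_metric A g (U, x)) (f \<circ> inv_into U x)
    (chart_metric (static_atlas A) (static_metric A g f) (U \<times> UNIV, static_map x))"
proof -
  have A: "smooth_atlas A" using R by (simp add: riemannian_manifold_def)
  interpret chart_metric_on "x ` U" "chart_metric A g (U, x)"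
    by (rule riemannian_chart_metric_on[OF R c])
  show ?thesis
  proof
    show "smooth_on (x ` U) (f \<circ> inv_into U x)"
      using f(1) c unfolding smooth_fun_on_def by auto
  qed (simp_all add: f(2) static_chart_metric[OF A c])
qed

lemma smooth_fun_on_static_chart:
  assumes A: "smooth_atlas A" and c: "(U, x) \<in> A" and F: "smooth_fun_on (static_atlas A) UNIV F"
  shows "smooth_on (x ` U \<times> UNIV) (F \<circ> inv_into (U \<times> UNIV) (static_map x))"
proof -
  have "(U \<times> UNIV, static_map x) \<in> static_atlas A" using c by (auto simp: static_atlas_iff)
  then have "smooth_on (static_map x ` (U \<times> UNIV)) (F \<circ> inv_into (U \<times> UNIV) (static_map x))"
    using F unfolding smooth_fun_on_def by fastforce
  then show ?thesis by (simp only: static_map_image)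
qed

lemma smooth_fun_on_slice:
  assumes A: "smooth_atlas A" and F: "smooth_fun_on (static_atlas A) UNIV F"
  shows "smooth_fun_on A UNIV (\<lambda>p. F (p, t))"
  unfolding smooth_fun_on_def
proof clarify
  fix U x assume c: "(U, x) \<in> A"
  have bl: "bounded_linear (\<lambda>q::'b. (q, 0::real))"
    by (intro bounded_linear_Pair bounded_linear_ident bounded_linear_zero)
  have "smooth_on (x ` U) (\<lambda>q. (F \<circ> inv_into (U \<times> UNIV) (static_map x)) ((q, 0) + (0, t)))"
    by (rule smooth_on_affine_compose[OF bl smooth_fun_on_static_chart[OF A c F] chart_open(2)[OF A c]])
      auto
  then have "smooth_on (x ` U) ((\<lambda>p. F (p, t)) \<circ> inv_into U x)"
    by (rule smooth_on_cong[OF _ chart_open(2)[OF A c]]) (simp add: static_map_inverse[OF A c])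
  then show "smooth_on (x ` (U \<inter> UNIV)) ((\<lambda>p. F (p, t)) \<circ> inv_into U x)" by simp
qed

lemma hessian_slice:
  assumes R: "riemannian_manifold A g" and c: "(U, x) \<in> A" and p: "p \<in> U"
    and f: "smooth_fun_on A UNIV f" "\<And>p. f p \<noteq> 0" and F: "smooth_fun_on (static_atlas A) UNIV F"
  shows "hessian (static_atlas A) (static_metric A g f) F (U \<times> UNIV, static_map x) (p, t) (u, 0) (v, 0)
    = hessian A g (\<lambda>p. F (p, t)) (U, x) p u v"
proof -
  have A: "smooth_atlas A" using R by (simp add: riemannian_manifold_def)
  interpret static_chart "x ` U" "chart_metric A g (U, x)" "f \<circ> inv_into U x"
    "chart_metric (static_atlas A) (static_metric A g f) (U \<times> UNIV, static_map x)"
    by (rule static_chart_of_static_metric[OF R c f])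
  have z: "x p \<in> x ` U" using p by simp
  show ?thesis
    by (simp add: hessian_def chart_hessian_H[OF z smooth_fun_on_static_chart[OF A c F]])
      (rule chart_hessian_cong[OF open_S z], simp add: static_map_inverse[OF A c])
qed

lemma ricci_slice:
  assumes R: "riemannian_manifold A g" and c: "(U, x) \<in> A" and p: "p \<in> U"
    and f: "smooth_fun_on A UNIV f" "\<And>p. f p \<noteq> 0"
  shows "ricci (static_atlas A) (static_metric A g f) (U \<times> UNIV, static_map x) (p, t) (u, 0) (v, 0)
    = ricci A g (U, x) p u v - hessian A g f (U, x) p u v / f p"
proof -
  have A: "smooth_atlas A" using R by (simp add: riemannian_manifold_def)
  interpret static_chart "x ` U" "chart_metric A g (U, x)" "f \<circ> inv_into U x"
    "chart_metric (static_atlas A) (static_metric A g f) (U \<times> UNIV, static_map x)"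
    by (rule static_chart_of_static_metric[OF R c f])
  have z: "x p \<in> x ` U" using p by simp
  show ?thesis
    by (simp add: ricci_def hessian_def chart_ricci_H[OF z] chart_inverse[OF A c p])
qed


section \<open>Solitons on static spacetimes\<close>

theorem theorem3p1:
  fixes A :: "('m::{t2_space,second_countable_topology}, 'e::euclidean_space) chart set"
    and g :: "'m metric"
    and f :: "'m \<Rightarrow> real"
    and l' \<phi>' :: "'m \<times> real \<Rightarrow> real"
    and t\<^sub>0 :: real
  assumes "riemannian_manifold A g"
    and "smooth_fun_on A UNIV f"
    and "\<forall>p. f p > 0"
    and "almost_gradient_ricci_soliton (static_atlas A) (static_metric A g f) l' \<phi>'"
    and "\<forall>c\<in>A. \<forall>p\<in>fst c. \<forall>u v. hessian A g f c p u v = 0"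
  shows "almost_gradient_ricci_soliton A g (\<lambda>p. l' (p, t\<^sub>0)) (\<lambda>p. \<phi>' (p, t\<^sub>0))"
proof -
  have A: "smooth_atlas A" using assms(1) by (simp add: riemannian_manifold_def)
  have f0: "f p \<noteq> 0" for p using assms(3) by (metis less_irrefl)
  have l': "smooth_fun_on (static_atlas A) UNIV l'" and \<phi>': "smooth_fun_on (static_atlas A) UNIV \<phi>'"
    using assms(4) by (simp_all add: almost_gradient_ricci_soliton_def)
  have "hessian A g (\<lambda>p. \<phi>' (p, t\<^sub>0)) (U, x) p u v + ricci A g (U, x) p u v
      + l' (p, t\<^sub>0) * g p (coord_vector A (U, x) p u) (coord_vector A (U, x) p v) = 0"
    if c: "(U, x) \<in> A" and p: "p \<in> U" for U x p u v
  proof -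
    let ?c = "(U \<times> UNIV, static_map x) :: ('m \<times> real, 'e \<times> real) chart"
    have "?c \<in> static_atlas A" "(p, t\<^sub>0) \<in> fst ?c"
      using c p by (auto simp: static_atlas_iff)
    then have "hessian (static_atlas A) (static_metric A g f) \<phi>' ?c (p, t\<^sub>0) (u, 0) (v, 0)
        + ricci (static_atlas A) (static_metric A g f) ?c (p, t\<^sub>0) (u, 0) (v, 0)
        + l' (p, t\<^sub>0) * static_metric A g f (p, t\<^sub>0)
            (coord_vector (static_atlas A) ?c (p, t\<^sub>0) (u, 0))
            (coord_vector (static_atlas A) ?c (p, t\<^sub>0) (v, 0)) = 0"
      using assms(4) unfolding almost_gradient_ricci_soliton_def by blast
    moreover have "hessian A g f (U, x) p u v = 0"
      using assms(5) c p by (metis fst_conv)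
    ultimately show ?thesis
      using static_metric_coord_vector[OF A c p, of g f t\<^sub>0 u 0 v 0]
      by (simp add: hessian_slice[OF assms(1) c p assms(2) f0 \<phi>']
          ricci_slice[OF assms(1) c p assms(2) f0])
  qed
  then show ?thesis
    using riemannian_imp_semi_riemannian[OF assms(1)] smooth_fun_on_slice[OF A l']
      smooth_fun_on_slice[OF A \<phi>']
    by (auto simp: almost_gradient_ricci_soliton_def)
qed

end
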